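(* Let $B\in\mathrm{M}_3(\mathbb{R})$ be a real cluster-cyclic skew-symmetrizable matrix. Then for every reduced sequence $\mathbf w\in\mathcal T$ the $C$-matrix $C^{\mathbf w}$ is sign-coherent, i.e. the $C$-pattern $\{C^{\mathbf w}\}_{\mathbf w\in\mathcal T}$ is sign-coherent.
   Context: A matrix $B=(b_{ij})\in\mathrm{M}_3(\mathbb{R})$ is skew-symmetrizable if there is $D=\mathrm{diag}(d_1,d_2,d_3)$ with all $d_i>0$ such that $DB$ is skew-symmetric. Notation: $[a]_+=\max(a,0)$ for $a\in\mathbb R$, applied entrywise to matrices; $J_k$ is the $3\times 3$ diagonal matrix whose $k$th diagonal entry is $-1$ and the others $1$; for a matrix $A$, $A^{\bullet k}$ (resp. $A^{k\bullet}$) is the matrix having the same $k$th column (resp. $k$th row) as $A$ and all other entries $0$. The mutation in direction $k\in\{1,2,3\}$ is $\mu_k(B)=(J_k+[-B]_+^{\bullet k})B(J_k+[B]_+^{k\bullet})$. A sequence $\mathbf w=[k_1,\dots,k_r]$ with $k_i\in\{1,2,3\}$ is reduced if $k_i\ne k_{i+1}$ for all $i$; $\mathcal T$ denotes the set of reduced sequences (including the empty sequence $\emptyset$). For $k\in\{1,2,3\}$, $\mathbf w[k]=[k_1,\dots,k_r,k]$ if $\mathbf w=\emptyset$ or $k\neq k_r$, and $\mathbf w[k]=[k_1,\dots,k_{r-1}]$ if $k=k_r$. Put $B^{\mathbf w}=\mu_{k_r}\cdots\mu_{k_1}(B)$ (so $B^{\emptyset}=B$). The $C$-matrices are defined recursively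 by $C^{\emptyset}=I$ and $C^{\mathbf w[k]}=C^{\mathbf w}J_k+C^{\mathbf w}[B^{\mathbf w}]_+^{k\bullet}+[-C^{\mathbf w}]_+^{\bullet k}B^{\mathbf w}$. The $i$th column $\mathbf c_i^{\mathbf w}$ of $C^{\mathbf w}$ is a $c$-vector. For vectors in $\mathbb R^3$, $\mathbf u\le\mathbf v$ means $u_i\le v_i$ for all $i$. $C^{\mathbf w}$ is called sign-coherent if for each $i$ either $\mathbf c_i^{\mathbf w}\ge\mathbf 0$ or $\mathbf c_i^{\mathbf w}\le \mathbf 0$. $B$ is cyclic if $\mathrm{sign}(B)=\pm\begin{pmatrix}0&-1&1\\1&0&-1\\-1&1&0\end{pmatrix}$ (sign taken entrywise), and cluster-cyclic if $B^{\mathbf w}$ is cyclic for every $\mathbf w\in\mathcal T$. *)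

theory Defs
  imports "HOL-Analysis.Analysis"
begin

definition diag_matrix :: "real^3 \<Rightarrow> real^3^3"
  where "diag_matrix d = (\<chi> i j. if i = j then d $ i else 0)"

definition skew_symmetrizable :: "real^3^3 \<Rightarrow> bool"
  where "skew_symmetrizable B \<longleftrightarrow>
    (\<exists>d. (\<forall>i. d $ i > 0) \<and> transpose (diag_matrix d ** B) = - (diag_matrix d ** B))"

definition pos_part :: "real^3^3 \<Rightarrow> real^3^3"
  where "pos_part A = (\<chi> i j. max (A $ i $ j) 0)"

definition J_matrix :: "3 \<Rightarrow> real^3^3"
  where "J_matrix k = diag_matrix (\<chi> i. if i = k then -1 else 1)"

definition only_column :: "3 \<Rightarrow> real^3^3 \<Rightarrow> real^3^3"
  where "only_column k A = (\<chi> i j. if j = k then A $ i $ j else 0)"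

definition only_row :: "3 \<Rightarrow> real^3^3 \<Rightarrow> real^3^3"
  where "only_row k A = (\<chi> i j. if i = k then A $ i $ j else 0)"

definition B_mutation :: "3 \<Rightarrow> real^3^3 \<Rightarrow> real^3^3"
  where "B_mutation k B =
    (J_matrix k + only_column k (pos_part (- B))) ** B ** (J_matrix k + only_row k (pos_part B))"

definition C_mutation :: "3 \<Rightarrow> real^3^3 \<Rightarrow> real^3^3 \<Rightarrow> real^3^3"
  where "C_mutation k B C =
    C ** J_matrix k + C ** only_row k (pos_part B) + only_column k (pos_part (- C)) ** B"

text \<open>Directions are elements of the three-element index type, whose numeral \<open>3\<close> denotes the
  same element as \<open>0\<close>. A sequence \<open>[k1, \<dots>, kr]\<close> is performed from left to right.\<close>

definition reduced_seqs :: "3 list set"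
  where "reduced_seqs = {w. distinct_adj w}"

definition seq_mutation :: "3 list \<Rightarrow> 3 \<Rightarrow> 3 list"
  where "seq_mutation w k = (if w = [] \<or> k \<noteq> last w then w @ [k] else butlast w)"

definition B_pattern :: "real^3^3 \<Rightarrow> 3 list \<Rightarrow> real^3^3"
  where "B_pattern B w = foldl (\<lambda>A k. B_mutation k A) B w"

text \<open>The pairs \<open>(B\<^sup>w, C\<^sup>w)\<close> are mutated simultaneously. The fold only uses the recursion for
  \<open>C\<^sup>w\<close> when a direction is appended; that the recursion also holds when the last direction is
  cancelled is lemma \<open>C_pattern_seq_mutation\<close>.\<close>

definition C_pattern :: "real^3^3 \<Rightarrow> 3 list \<Rightarrow> real^3^3"
  where "C_pattern B w =
    snd (foldl (\<lambda>(A, C) k. (B_mutation k A, C_mutation k A C)) (B, mat 1) w)"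

definition sign_coherent :: "real^3^3 \<Rightarrow> bool"
  where "sign_coherent C \<longleftrightarrow> (\<forall>i. column i C \<ge> 0 \<or> column i C \<le> 0)"

definition sign_matrix :: "real^3^3 \<Rightarrow> real^3^3"
  where "sign_matrix B = (\<chi> i j. sgn (B $ i $ j))"

definition cyclic_sign :: "real^3^3"
  where "cyclic_sign = vector [vector [0, -1, 1], vector [1, 0, -1], vector [-1, 1, 0]]"

definition cyclic :: "real^3^3 \<Rightarrow> bool"
  where "cyclic B \<longleftrightarrow> sign_matrix B = cyclic_sign \<or> sign_matrix B = - cyclic_sign"

definition cluster_cyclic :: "real^3^3 \<Rightarrow> bool"
  where "cluster_cyclic B \<longleftrightarrow> (\<forall>w\<in>reduced_seqs. cyclic (B_pattern B w))"

lemma B_pattern_Nil [simp]: "B_pattern B [] = B"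
  by (simp add: B_pattern_def)

lemma B_pattern_snoc [simp]: "B_pattern B (w @ [k]) = B_mutation k (B_pattern B w)"
  by (simp add: B_pattern_def)

lemma C_pattern_Nil [simp]: "C_pattern B [] = mat 1"
  by (simp add: C_pattern_def)

lemma C_pattern_snoc [simp]:
  "C_pattern B (w @ [k]) = C_mutation k (B_pattern B w) (C_pattern B w)"
proof -
  have "fst (foldl (\<lambda>(A, C) k. (B_mutation k A, C_mutation k A C)) (B, mat 1) w)
          = B_pattern B w"
    by (induction w rule: rev_induct) (auto simp: split_def)
  then show ?thesis
    by (simp add: C_pattern_def split_def)
qed

lemma B_mutation_nth:
  assumes "B $ k $ k = 0"
  shows "B_mutation k B $ i $ j =
    (if i = k \<or> j = k then - B $ i $ j
     else B $ i $ j + max (- B $ i $ k) 0 * B $ k $ j + B $ i $ k * max (B $ k $ j) 0)"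
  using assms exhaust_3[of i] exhaust_3[of j] exhaust_3[of k]
  by (auto simp: B_mutation_def J_matrix_def diag_matrix_def only_column_def only_row_def
      pos_part_def matrix_matrix_mult_def sum_3)

lemma C_mutation_nth:
  assumes "B $ k $ k = 0"
  shows "C_mutation k B C $ i $ j =
    (if j = k then - C $ i $ j
     else C $ i $ j + C $ i $ k * max (B $ k $ j) 0 + max (- C $ i $ k) 0 * B $ k $ j)"
  using assms exhaust_3[of j] exhaust_3[of k]
  by (auto simp: C_mutation_def J_matrix_def diag_matrix_def only_column_def only_row_def
      pos_part_def matrix_matrix_mult_def sum_3)

lemma mutation_involution:
  assumes "B $ k $ k = 0"
  shows "B_mutation k (B_mutation k B) = B"
    and "C_mutation k (B_mutation k B) (C_mutation k B C) = C"
proof -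
  have d: "B_mutation k B $ k $ k = 0"
    using assms by (simp add: B_mutation_nth)
  show "B_mutation k (B_mutation k B) = B"
    using assms d by (auto simp: vec_eq_iff B_mutation_nth max_def algebra_simps)
  show "C_mutation k (B_mutation k B) (C_mutation k B C) = C"
    using assms d by (auto simp: vec_eq_iff B_mutation_nth C_mutation_nth max_def algebra_simps)
qed

lemma
  assumes "cluster_cyclic B" and "w \<in> reduced_seqs"
  shows B_pattern_seq_mutation:
      "B_pattern B (seq_mutation w k) = B_mutation k (B_pattern B w)"
    and C_pattern_seq_mutation:
      "C_pattern B (seq_mutation w k) = C_mutation k (B_pattern B w) (C_pattern B w)"
proof -
  have diag: "B_pattern B v $ k $ k = 0" if "v \<in> reduced_seqs" for v
  proof -
    have "sgn (B_pattern B v $ k $ k) = 0"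
      using assms(1) that exhaust_3[of k]
      by (auto simp: cluster_cyclic_def cyclic_def sign_matrix_def cyclic_sign_def
          vec_eq_iff forall_3 dest!: bspec)
    then show ?thesis
      by (simp add: sgn_zero_iff)
  qed
  have "B_pattern B (seq_mutation w k) = B_mutation k (B_pattern B w) \<and>
      C_pattern B (seq_mutation w k) = C_mutation k (B_pattern B w) (C_pattern B w)"
  proof (cases "w = [] \<or> k \<noteq> last w")
    case True
    then show ?thesis
      by (simp only: seq_mutation_def if_True B_pattern_snoc C_pattern_snoc)
  next
    case False
    then obtain v where v: "w = v @ [k]"
      by (metis append_butlast_last_id)
    then have "v \<in> reduced_seqs"
      using assms(2) by (simp add: reduced_seqs_def distinct_adj_append_iff)
    then show ?thesis
      using diag[of v] v by (simp add: seq_mutation_def mutation_involution)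
  qed
  then show "B_pattern B (seq_mutation w k) = B_mutation k (B_pattern B w)"
    and "C_pattern B (seq_mutation w k) = C_mutation k (B_pattern B w) (C_pattern B w)"
    by auto
qed

end

theory Submission
  imports Defs
begin

text \<open>
  Let \<open>K\<close> be the last direction of \<open>w\<close>, and suppose that the columns of \<open>C\<^sup>w\<close> have signs
  \<open>\<epsilon>\<^sub>i\<close>. Mutation at \<open>k\<close> changes, besides column \<open>k\<close>, only the column \<open>j\<close> with
  \<open>\<epsilon>\<^sub>k b\<^sub>k\<^sub>j > 0\<close>; write \<open>k \<rightarrow> j\<close>. After mutation at \<open>K\<close> there is a \<open>T\<close> with
  \<open>K \<rightarrow> T\<close> and \<open>T \<rightarrow> K\<close>, so columns \<open>K\<close> and \<open>T\<close> have opposite signs and a mutation at \<open>T\<close> is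
  the only one that could destroy sign-coherence. It does not, because of the invariant
  \<open>2 \<bar>c\<^sub>K\<bar> \<le> \<bar>b\<^sub>T\<^sub>K\<bar> \<bar>c\<^sub>T\<bar>\<close>, which is preserved as soon as all \<open>\<bar>b\<^sub>i\<^sub>j b\<^sub>j\<^sub>i\<bar> \<ge> 4\<close>. The latter bound
  follows from cluster-cyclicity: if it failed for \<open>i, j\<close>, alternating mutations at \<open>i\<close> and \<open>j\<close>
  would act like an elliptic rotation on the remaining entries and could not keep them positive.
\<close>

section \<open>Sign patterns of cyclic matrices\<close>

lemma UNIV_3_distinct:
  fixes i j k m :: 3
  assumes "i \<noteq> j" "j \<noteq> k" "i \<noteq> k"
  shows "m = i \<or> m = j \<or> m = k"
  using assms exhaust_3[of i] exhaust_3[of j] exhaust_3[of k] exhaust_3[of m] by auto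

lemma obtain_third_index:
  fixes i j :: 3
  obtains l where "i \<noteq> l" "j \<noteq> l"
proof -
  have "card {i, j} < card (UNIV :: 3 set)"
    by (cases "i = j") auto
  then have "{i, j} \<noteq> UNIV"
    by auto
  then obtain l where "l \<notin> {i, j}"
    by blast
  then show ?thesis
    using that[of l] by auto
qed

lemma cyclic_diag:
  assumes "cyclic A"
  shows "A $ k $ k = 0"
  using assms exhaust_3[of k]
  by (auto simp: cyclic_def sign_matrix_def cyclic_sign_def vec_eq_iff forall_3 sgn_zero_iff)

lemma cyclic_cases:
  assumes "cyclic A" "i \<noteq> j" "j \<noteq> l" "i \<noteq> l"
  obtains
    (pos) "A $ i $ j > 0" "A $ j $ l > 0" "A $ l $ i > 0"
          "A $ j $ i < 0" "A $ l $ j < 0" "A $ i $ l < 0"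
  | (neg) "A $ i $ j < 0" "A $ j $ l < 0" "A $ l $ i < 0"
          "A $ j $ i > 0" "A $ l $ j > 0" "A $ i $ l > 0"
proof -
  have "(A $ 1 $ 2 < 0 \<and> A $ 2 $ 3 < 0 \<and> A $ 3 $ 1 < 0 \<and> A $ 2 $ 1 > 0 \<and> A $ 3 $ 2 > 0 \<and> A $ 1 $ 3 > 0)
      \<or> (A $ 1 $ 2 > 0 \<and> A $ 2 $ 3 > 0 \<and> A $ 3 $ 1 > 0 \<and> A $ 2 $ 1 < 0 \<and> A $ 3 $ 2 < 0 \<and> A $ 1 $ 3 < 0)"
    using assms(1)
    by (auto simp: cyclic_def sign_matrix_def cyclic_sign_def vec_eq_iff forall_3 sgn_1_pos sgn_1_neg)
  then show ?thesis
    using assms(2-4) exhaust_3[of i] exhaust_3[of j] exhaust_3[of l] that by auto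
qed

text \<open>Row and column \<open>i\<close> change sign, so cyclicity of the mutated matrix forces
  its (\<open>j\<close>, \<open>l\<close>) entry to change sign too: the added product, opposite in
  sign to the old entry, outweighs it.\<close>

lemma abs_B_mutation_nth:
  assumes "cyclic A" "cyclic (B_mutation i A)" "i \<noteq> j" "j \<noteq> l" "i \<noteq> l"
  shows "\<bar>A $ j $ l\<bar> + \<bar>B_mutation i A $ j $ l\<bar> = \<bar>A $ j $ i\<bar> * \<bar>A $ i $ l\<bar>"
proof -
  have d: "A $ i $ i = 0"
    using assms(1) by (rule cyclic_diag)
  show ?thesis
    using assms(1,3-5)
  proof (cases rule: cyclic_cases)
    case pos
    have "B_mutation i A $ j $ l < 0"
      using assms(2-5) by (rule cyclic_cases) (use pos assms in \<open>auto simp: B_mutation_nth[OF d]\<close>)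
    then show ?thesis
      using pos assms by (auto simp: B_mutation_nth[OF d])
  next
    case neg
    have "B_mutation i A $ j $ l > 0"
      using assms(2-5) by (rule cyclic_cases) (use neg assms in \<open>auto simp: B_mutation_nth[OF d]\<close>)
    then show ?thesis
      using neg assms by (auto simp: B_mutation_nth[OF d])
  qed
qed

section \<open>Lower bound for products of opposite entries\<close>

lemma cyclic_nonzero:
  assumes "cyclic A" "i \<noteq> j"
  shows "A $ i $ j \<noteq> 0"
proof -
  obtain l where "l \<noteq> i" "l \<noteq> j"
    using obtain_third_index[of i j] by metis
  then show ?thesis
    using assms by (metis cyclic_cases order_less_irrefl)
qed

text \<open>Working in a closed set lets an induction restart from the mutated matrix without
  tracking sequences.\<close>

locale mutation_closed =
  fixes G :: "(real^3^3) set"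
  assumes cyc: "A \<in> G \<Longrightarrow> cyclic A"
    and closed: "A \<in> G \<Longrightarrow> B_mutation k A \<in> G"
begin

text \<open>
  With \<open>q = \<bar>a\<^sub>j\<^sub>l\<bar> / (\<bar>a\<^sub>j\<^sub>i\<bar> \<bar>a\<^sub>i\<^sub>l\<bar>)\<close>, mutating at \<open>i\<close> and swapping the roles of \<open>i\<close> and \<open>j\<close>
  turns \<open>q\<close> into \<open>q'\<close> with \<open>\<kappa> q' (1 - q) = 1\<close>. For \<open>\<kappa> < 4\<close> this increases \<open>q\<close> by at least
  \<open>1 / \<kappa> - 1 / 4\<close>, although \<open>q < 1\<close> always.
\<close>

lemma ratio_bound:
  assumes "A \<in> G" "i \<noteq> j" "j \<noteq> l" "i \<noteq> l" "\<bar>A $ i $ j\<bar> * \<bar>A $ j $ i\<bar> = \<kappa>" "\<kappa> < 4"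
  shows "\<bar>A $ j $ l\<bar> / (\<bar>A $ j $ i\<bar> * \<bar>A $ i $ l\<bar>) < 1 - real n * (1 / \<kappa> - 1 / 4)"
  using assms
proof (induction n arbitrary: A i j)
  case 0
  note nz = cyclic_nonzero[OF cyc[OF 0(1)]]
  have "\<bar>B_mutation i A $ j $ l\<bar> > 0"
    using cyclic_nonzero[OF cyc[OF closed[OF 0(1)]]] 0 by simp
  then show ?case
    using abs_B_mutation_nth[OF cyc[OF 0(1)] cyc[OF closed[OF 0(1)]] 0(2-4)] nz 0
    by (simp add: divide_simps mult_less_0_iff)
next
  case (Suc n)
  define A' where "A' = B_mutation i A"
  have A': "A' \<in> G"
    using Suc.prems closed by (simp add: A'_def)
  note nz = cyclic_nonzero[OF cyc[OF Suc.prems(1)]] and nz' = cyclic_nonzero[OF cyc[OF A']]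
  have d: "A $ i $ i = 0"
    using cyc[OF Suc.prems(1)] by (rule cyclic_diag)
  define x y z a b where "x = \<bar>A $ j $ l\<bar>" and "y = \<bar>A $ i $ l\<bar>" and "z = \<bar>A' $ j $ l\<bar>"
    and "a = \<bar>A $ i $ j\<bar>" and "b = \<bar>A $ j $ i\<bar>"
  note defs = x_def y_def z_def a_def b_def
  have pos: "x > 0" "y > 0" "z > 0" "a > 0" "b > 0"
    using nz nz' Suc.prems by (auto simp: defs)
  have k: "\<kappa> = a * b"
    using Suc.prems by (simp add: defs)
  have e: "\<bar>A' $ i $ l\<bar> = y" "\<bar>A' $ i $ j\<bar> = a" "\<bar>A' $ j $ i\<bar> = b"
    by (simp_all add: defs A'_def B_mutation_nth[OF d])
  have sum: "x + z = b * y"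
    using abs_B_mutation_nth[OF cyc[OF Suc.prems(1)] _ Suc.prems(2-4)] A' cyc
    by (simp add: defs A'_def)
  have IH: "y / (a * z) < 1 - real n * (1 / \<kappa> - 1 / 4)"
    using Suc.IH[OF A', of j i] Suc.prems e by (simp add: z_def[symmetric] k mult.commute)
  define q where "q = x / (b * y)"
  define q' where "q' = y / (a * z)"
  have q1: "1 - q = z / (b * y)"
    using pos sum by (simp add: q_def field_simps)
  have "0 < 1 - q" "1 - q < 1"
    using pos sum by (auto simp: q1)
  have "\<kappa> > 0"
    using pos k by simp
  have rel: "q' * (1 - q) = 1 / \<kappa>"
    using pos by (simp add: q1 q'_def k)
  \<comment> \<open>Completing the square: q (1 - q) = 1/4 - (q - 1/2)^2, which is where the
    threshold 4 comes from.\<close>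
  have "(q' - q) * (1 - q) = 1 / \<kappa> - 1 / 4 + (q - 1 / 2)\<^sup>2"
    by (simp add: left_diff_distrib rel) (simp add: power2_eq_square algebra_simps)
  then have *: "(q' - q) * (1 - q) \<ge> 1 / \<kappa> - 1 / 4"
    by simp
  have "1 / \<kappa> - 1 / 4 > 0"
    using \<open>\<kappa> > 0\<close> \<open>\<kappa> < 4\<close> by (simp add: field_simps)
  with * have "(q' - q) * (1 - q) > 0"
    by linarith
  then have "q' - q > 0"
    using \<open>0 < 1 - q\<close> by (simp add: zero_less_mult_iff)
  then have "(q' - q) * (1 - q) \<le> q' - q"
    using \<open>1 - q < 1\<close> by (simp add: mult_le_cancel_left1)
  with * have "1 / \<kappa> - 1 / 4 \<le> q' - q"
    by linarith
  moreover have "q' < 1 - real n * (1 / \<kappa> - 1 / 4)"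
    using IH by (simp add: q'_def)
  ultimately have "q < 1 - real n * (1 / \<kappa> - 1 / 4) - (1 / \<kappa> - 1 / 4)"
    by linarith
  also have "\<dots> = 1 - real (Suc n) * (1 / \<kappa> - 1 / 4)"
    by (simp add: algebra_simps add_divide_distrib)
  finally show ?case
    by (simp add: q_def defs)
qed

lemma entry_prod_ge_4:
  assumes "A \<in> G" "i \<noteq> j"
  shows "\<bar>A $ i $ j\<bar> * \<bar>A $ j $ i\<bar> \<ge> 4"
proof (rule ccontr)
  define \<kappa> where "\<kappa> = \<bar>A $ i $ j\<bar> * \<bar>A $ j $ i\<bar>"
  assume "\<not> ?thesis"
  then have k4: "\<kappa> < 4"
    by (simp add: \<kappa>_def)
  obtain l where l: "j \<noteq> l" "i \<noteq> l"
    using obtain_third_index[of i j] by metis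
  have "\<kappa> > 0"
    using cyclic_nonzero[OF cyc[OF assms(1)]] assms(2) by (simp add: \<kappa>_def)
  then have "1 / \<kappa> - 1 / 4 > 0"
    using k4 by (simp add: field_simps)
  \<comment> \<open>For this \<open>n\<close> the bound of \<open>ratio_bound\<close> is negative,
    but the ratio is not.\<close>
  then obtain n where "1 < real n * (1 / \<kappa> - 1 / 4)"
    using reals_Archimedean3 by blast
  moreover have "\<bar>A $ j $ l\<bar> / (\<bar>A $ j $ i\<bar> * \<bar>A $ i $ l\<bar>) < 1 - real n * (1 / \<kappa> - 1 / 4)"
    using ratio_bound[OF assms l \<kappa>_def[symmetric] k4] .
  moreover have "\<bar>A $ j $ l\<bar> / (\<bar>A $ j $ i\<bar> * \<bar>A $ i $ l\<bar>) \<ge> 0"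
    by simp
  ultimately show False
    by linarith
qed

end

lemma cluster_cyclic_mutation_closed:
  assumes "cluster_cyclic B"
  shows "mutation_closed (B_pattern B ` reduced_seqs)"
proof
  show "cyclic A" if "A \<in> B_pattern B ` reduced_seqs" for A
    using assms that by (auto simp: cluster_cyclic_def)
  show "B_mutation k A \<in> B_pattern B ` reduced_seqs" if A: "A \<in> B_pattern B ` reduced_seqs" for A k
  proof -
    obtain w where w: "w \<in> reduced_seqs" "A = B_pattern B w"
      using A by auto
    have "seq_mutation w k \<in> reduced_seqs"
    proof (cases "w = [] \<or> k \<noteq> last w")
      case True
      then show ?thesis
        using w by (auto simp: reduced_seqs_def seq_mutation_def distinct_adj_append_iff)
    next
      case False
      then have "distinct_adj (butlast w @ [last w])"
        using w by (simp add: reduced_seqs_def)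
      with False show ?thesis
        by (simp add: reduced_seqs_def seq_mutation_def distinct_adj_append_iff del: append_butlast_last_id)
    qed
    then show ?thesis
      using B_pattern_seq_mutation[OF assms w(1)] w(2) by (metis imageI)
  qed
qed

section \<open>Column signs and the invariant\<close>

definition column_signs :: "(3 \<Rightarrow> real) \<Rightarrow> real^3^3 \<Rightarrow> bool"
  where "column_signs e C \<longleftrightarrow> (\<forall>i. \<bar>e i\<bar> = 1) \<and> (\<forall>r i. e i * C $ r $ i \<ge> 0)"

lemma column_signs_imp_sign_coherent:
  assumes "column_signs e C"
  shows "sign_coherent C"
  unfolding sign_coherent_def
proof
  fix i
  have "e i = 1 \<or> e i = -1" "\<forall>r. e i * C $ r $ i \<ge> 0"
    using assms by (auto simp: column_signs_def abs_if split: if_splits)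
  then show "column i C \<ge> 0 \<or> column i C \<le> 0"
    by (auto simp: less_eq_vec_def column_def)
qed

text \<open>For c of sign e the two correction terms merge: c [b]_+ + [-c]_+ b = c [e b]_+.\<close>

lemma C_mutation_signed_nth:
  assumes "A $ k $ k = 0" "column_signs e C"
  shows "C_mutation k A C $ r $ j =
    (if j = k then - C $ r $ k else C $ r $ j + C $ r $ k * max (e k * A $ k $ j) 0)"
proof -
  have "e k = 1 \<or> e k = -1" "e k * C $ r $ k \<ge> 0"
    using assms by (auto simp: column_signs_def abs_if split: if_splits)
  then show ?thesis
    by (auto simp: C_mutation_nth[OF assms(1)] max_def algebra_simps)
qed

text \<open>As \<open>A $ T $ K\<close> and column \<open>T\<close> both carry the sign
  \<open>e T\<close>, the right-hand side of the inequality is a product of absolute values.\<close>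

definition linked_pair :: "real^3^3 \<Rightarrow> real^3^3 \<Rightarrow> 3 \<Rightarrow> 3 \<Rightarrow> (3 \<Rightarrow> real) \<Rightarrow> bool"
  where "linked_pair A C K T e \<longleftrightarrow> K \<noteq> T \<and> column_signs e C \<and>
    e K * A $ K $ T > 0 \<and> e T * A $ T $ K > 0 \<and>
    (\<forall>r. 2 * (e K * C $ r $ K) \<le> A $ T $ K * C $ r $ T)"

text \<open>Creates the invariant from signs alone: column \<open>j\<close> gains a multiple of
  column \<open>k\<close>, which has the same sign, and the product bound 4 more than covers the
  factor 2.\<close>

lemma linked_pair_growing:
  assumes cyc: "cyclic A" and ge4: "\<And>i j. i \<noteq> j \<Longrightarrow> \<bar>A $ i $ j\<bar> * \<bar>A $ j $ i\<bar> \<ge> 4"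
    and distinct: "k \<noteq> j" "j \<noteq> i" "k \<noteq> i"
    and e: "column_signs e C" "e j = e k" "e k * A $ k $ j > 0"
  shows "linked_pair (B_mutation k A) (C_mutation k A C) k j (e(k := - e k))"
proof -
  have d: "A $ k $ k = 0"
    using cyc by (rule cyclic_diag)
  have ek: "e k = 1 \<or> e k = -1" and en: "\<And>i r. e i * C $ r $ i \<ge> 0" and ea: "\<And>i. \<bar>e i\<bar> = 1"
    using e by (auto simp: column_signs_def abs_if split: if_splits)
  have s: "e k * A $ j $ k < 0" "e k * A $ k $ i < 0"
    using cyc distinct by (rule cyclic_cases; use e ek in auto)+
  define a b where "a = e k * A $ k $ j" and "b = - e k * A $ j $ k"
  have A: "A $ k $ j = e k * a" "A $ j $ k = - e k * b"
    using ek by (auto simp: a_def b_def)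
  have ab: "a > 0" "b > 0"
    using e s by (auto simp: a_def b_def)
  then have ab4: "a * b \<ge> 4"
    using ge4[of k j] distinct ek by (auto simp: A abs_mult)
  have C': "C_mutation k A C $ r $ k = - C $ r $ k"
    "C_mutation k A C $ r $ j = C $ r $ j + C $ r $ k * a"
    "C_mutation k A C $ r $ i = C $ r $ i" for r
    using distinct ab s by (auto simp: C_mutation_signed_nth[OF d e(1)] a_def)
  have "column_signs (e(k := - e k)) (C_mutation k A C)"
    unfolding column_signs_def
  proof safe
    fix r m
    show "\<bar>(e(k := - e k)) m\<bar> = 1"
      using ea by simp
    show "(e(k := - e k)) m * C_mutation k A C $ r $ m \<ge> 0"
      using UNIV_3_distinct[OF distinct, of m] en[of k r] en[of j r] en[of i r] ab distinct
      by (auto simp: C' distrib_left e(2) mult.assoc[symmetric])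
  qed
  moreover have "2 * (e k * C $ r $ k) \<le> e k * b * (C $ r $ j + C $ r $ k * a)" for r
  proof -
    have "4 * (e k * C $ r $ k) \<le> (a * b) * (e k * C $ r $ k)"
      using ab4 en by (rule mult_right_mono)
    moreover have "b * (e k * C $ r $ j) \<ge> 0"
      using ab en[of j r] e(2) by simp
    ultimately show ?thesis
      using en[of k r] by (simp add: algebra_simps)
  qed
  ultimately show ?thesis
    using distinct ab ek by (auto simp: linked_pair_def C' B_mutation_nth[OF d] A e(2))
qed

text \<open>The critical direction: columns of opposite sign are added, and the invariant makes
  column \<open>T\<close> win, so both columns switch sign.\<close>

lemma linked_pair_flip:
  assumes cyc: "cyclic A" and ge4: "\<And>i j. i \<noteq> j \<Longrightarrow> \<bar>A $ i $ j\<bar> * \<bar>A $ j $ i\<bar> \<ge> 4"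
    and lp: "linked_pair A C K T e"
  shows "linked_pair (B_mutation T A) (C_mutation T A C) T K (e(T := - e T, K := - e K))"
proof -
  have d: "A $ T $ T = 0"
    using cyc by (rule cyclic_diag)
  have KT: "K \<noteq> T" and e: "column_signs e C"
    and pos: "e K * A $ K $ T > 0" "e T * A $ T $ K > 0"
    and le: "\<And>r. 2 * (e K * C $ r $ K) \<le> A $ T $ K * C $ r $ T"
    using lp by (auto simp: linked_pair_def)
  obtain S where S: "K \<noteq> S" "T \<noteq> S"
    by (rule obtain_third_index)
  have eT: "e T = 1 \<or> e T = -1" and eK1: "e K = 1 \<or> e K = -1"
    and en: "\<And>i r. e i * C $ r $ i \<ge> 0" and ea: "\<And>i. \<bar>e i\<bar> = 1"
    using e by (auto simp: column_signs_def abs_if split: if_splits)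
  have s: "e T * A $ T $ S < 0" and eK: "e K = - e T"
    using cyc KT S(2,1) by (rule cyclic_cases; use pos eT eK1 in auto)+
  define a b where "a = e K * A $ K $ T" and "b = e T * A $ T $ K"
  have A: "A $ K $ T = - e T * a" "A $ T $ K = e T * b"
    using eT by (auto simp: a_def b_def eK)
  have ab: "a > 0" "b > 0"
    using pos by (auto simp: a_def b_def)
  then have ab4: "a * b \<ge> 4"
    using ge4[of K T] KT eT by (auto simp: A abs_mult)
  have C': "C_mutation T A C $ r $ T = - C $ r $ T"
    "C_mutation T A C $ r $ K = C $ r $ K + C $ r $ T * b"
    "C_mutation T A C $ r $ S = C $ r $ S" for r
    using KT S ab s by (auto simp: C_mutation_signed_nth[OF d e] b_def)
  define X Y where "X = (\<lambda>r. e K * C $ r $ K)" and "Y = (\<lambda>r. e T * C $ r $ T)"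
  have XY: "X r \<ge> 0" "Y r \<ge> 0" "2 * X r \<le> b * Y r" for r
    using en[of K r] en[of T r] le[of r] by (auto simp: X_def Y_def A mult_ac)
  have C: "C $ r $ K = - e T * X r" "C $ r $ T = e T * Y r" for r
    using eT by (auto simp: X_def Y_def eK)
  let ?e = "e(T := - e T, K := - e K)"
  have "column_signs ?e (C_mutation T A C)"
    unfolding column_signs_def
  proof safe
    fix r m
    show "\<bar>?e m\<bar> = 1"
      using ea by simp
    show "?e m * C_mutation T A C $ r $ m \<ge> 0"
      using UNIV_3_distinct[OF KT S(2,1), of m] KT S eT XY[of r] en[of S r]
      by (auto simp: C' eK C algebra_simps)
  qed
  \<comment> \<open>The factor 2 reproduces itself: a (b Y - X) \<ge> a b Y / 2 \<ge> 2 Y.\<close>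
  moreover have "2 * Y r \<le> a * (b * Y r - X r)" for r
  proof -
    have "a * (2 * X r) \<le> a * (b * Y r)"
      using XY ab by (intro mult_left_mono) auto
    moreover have "4 * Y r \<le> (a * b) * Y r"
      using ab4 XY by (intro mult_right_mono) auto
    ultimately show ?thesis
      by (simp add: algebra_simps)
  qed
  ultimately show ?thesis
    using KT ab eT by (auto simp: linked_pair_def C' B_mutation_nth[OF d] A eK C algebra_simps)
qed

section \<open>Induction along reduced sequences\<close>

lemma linked_pair_mutation:
  assumes cyc: "cyclic A" and ge4: "\<And>i j. i \<noteq> j \<Longrightarrow> \<bar>A $ i $ j\<bar> * \<bar>A $ j $ i\<bar> \<ge> 4"
    and lp: "linked_pair A C K T e" and "k \<noteq> K"
  shows "\<exists>T e. linked_pair (B_mutation k A) (C_mutation k A C) k T e"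
proof (cases "k = T")
  case True
  then show ?thesis
    using linked_pair_flip[OF cyc ge4 lp] by blast
next
  case False
  have KT: "K \<noteq> T" and e: "column_signs e C"
    and pos: "e K * A $ K $ T > 0" "e T * A $ T $ K > 0"
    using lp by (auto simp: linked_pair_def)
  have e1: "e i = 1 \<or> e i = -1" for i
    using e by (auto simp: column_signs_def abs_if split: if_splits)
  \<comment> \<open>Columns \<open>K\<close> and \<open>T\<close> have opposite signs, so exactly
    one agrees with column \<open>k\<close>; by cyclicity the arrow out of \<open>k\<close> points
    to that one.\<close>
  have "e k * A $ k $ K > 0 \<and> e K = e k \<or> e k * A $ k $ T > 0 \<and> e T = e k"
    using cyc KT False[symmetric] \<open>k \<noteq> K\<close>[symmetric]
    by (rule cyclic_cases; use pos e1[of k] e1[of K] e1[of T] in auto)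
  then show ?thesis
    using linked_pair_growing[OF cyc ge4 \<open>k \<noteq> K\<close> KT False e]
      linked_pair_growing[OF cyc ge4 False KT[symmetric] \<open>k \<noteq> K\<close> e] by blast
qed

lemma linked_pair_initial:
  assumes cyc: "cyclic A" and ge4: "\<And>i j. i \<noteq> j \<Longrightarrow> \<bar>A $ i $ j\<bar> * \<bar>A $ j $ i\<bar> \<ge> 4"
  shows "\<exists>T e. linked_pair (B_mutation k A) (C_mutation k A (mat 1)) k T e"
proof -
  have e: "column_signs (\<lambda>_. 1) (mat 1)"
    by (simp add: column_signs_def mat_def)
  obtain i j where d: "k \<noteq> j" "j \<noteq> i" "k \<noteq> i"
    using exhaust_3[of k] that[of 2 3] that[of 1 3] that[of 1 2] by force
  have "A $ k $ j > 0 \<or> A $ k $ i > 0"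
    using cyc d by (rule cyclic_cases) auto
  then show ?thesis
    using linked_pair_growing[OF cyc ge4 d e]
      linked_pair_growing[OF cyc ge4 d(3) d(2)[symmetric] d(1) e] by auto
qed

theorem theorem3p3:
  fixes B :: "real^3^3"
  assumes "skew_symmetrizable B"
    and "cluster_cyclic B"
  shows "\<forall>w\<in>reduced_seqs. sign_coherent (C_pattern B w)"
proof -
  interpret mutation_closed "B_pattern B ` reduced_seqs"
    using assms(2) by (rule cluster_cyclic_mutation_closed)
  \<comment> \<open>Reducedness excludes repeating the last direction, the case left out of
    \<open>linked_pair_mutation\<close>. The empty sequence has no last direction and is treated
    apart.\<close>
  have linked: "\<exists>T e. linked_pair (B_pattern B w) (C_pattern B w) (last w) T e"
    if "w \<in> reduced_seqs" "w \<noteq> []" for w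
    using that
  proof (induction w rule: rev_induct)
    case (snoc k w)
    then have w: "w \<in> reduced_seqs" and k: "w = [] \<or> k \<noteq> last w"
      by (auto simp: reduced_seqs_def distinct_adj_append_iff)
    have A: "cyclic (B_pattern B w)"
      "i \<noteq> j \<Longrightarrow> \<bar>B_pattern B w $ i $ j\<bar> * \<bar>B_pattern B w $ j $ i\<bar> \<ge> 4" for i j
      using w by (auto intro: cyc entry_prod_ge_4)
    show ?case
    proof (cases "w = []")
      case True
      then show ?thesis
        using linked_pair_initial[OF A] by (simp add: B_pattern_def C_pattern_def)
    next
      case False
      then obtain T e where "linked_pair (B_pattern B w) (C_pattern B w) (last w) T e"
        using snoc.IH w by blast
      then show ?thesis
        using linked_pair_mutation[OF A] k False by simp
    qed
  qed simp
  show ?thesis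
  proof
    fix w
    assume w: "w \<in> reduced_seqs"
    show "sign_coherent (C_pattern B w)"
    proof (cases "w = []")
      case True
      have "column_signs (\<lambda>_. 1) (mat 1)"
        by (simp add: column_signs_def mat_def)
      then show ?thesis
        using True by (auto intro: column_signs_imp_sign_coherent)
    next
      case False
      then show ?thesis
        using linked[OF w] by (auto simp: linked_pair_def intro: column_signs_imp_sign_coherent)
    qed
  qed
qed

end
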